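(* Let $T$ be a tree of order $n\ge 2$ without any open twins. Then $\gamma_L(T)=\frac{n}{2}$ if and only if $T\in\mathcal{T}$.
   Context: Graphs are finite, simple and undirected; the order of a graph is its number of vertices. For a vertex $v$, $N(v)$ denotes its open neighborhood. Two distinct vertices $u,v$ are open twins if $N(u)=N(v)$. A dominating set of $G$ is a set $D\subseteq V(G)$ such that every vertex outside $D$ has a neighbor in $D$. A locating-dominating set of $G$ is a dominating set $D$ such that $N(u)\cap D\neq N(v)\cap D$ for every two distinct vertices $u,v\in V(G)\setminus D$. The location-domination number $\gamma_L(G)$ is the minimum cardinality of a locating-dominating set of $G$. $\mathcal{T}$ is the family of all trees $T$ for which there exist a perfect matching $M$ of $T$ and a coloring of the vertices of $T$ with the colors black and white such that: (i) each edge of $M$ has one end colored white and the other end colored black; (ii) each white vertex is either a leaf (a vertex of degree 1), or has degree 2 and is adjacent to a black vertex that has a white leaf as a neighbor. *)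

theory Defs
  imports Complex_Main "Graph_Theory.Graph_Theory"
begin

text \<open>
  A finite simple undirected graph is a \<^locale>\<open>pair_graph\<close>: a finite, loop-free, symmetric digraph
  without parallel arcs, in which an undirected edge between \<open>u\<close> and \<open>v\<close> is the pair of arcs
  \<open>(u, v)\<close> and \<open>(v, u)\<close>.
\<close>

definition edges :: "'a pair_pre_digraph \<Rightarrow> 'a set set" where
  "edges G = {{u, v} | u v. (u, v) \<in> parcs G}"

definition nbhd :: "'a pair_pre_digraph \<Rightarrow> 'a \<Rightarrow> 'a set" where
  "nbhd G v = {u \<in> pverts G. (v, u) \<in> parcs G}"

definition degree :: "'a pair_pre_digraph \<Rightarrow> 'a \<Rightarrow> nat" where
  "degree G v = card (nbhd G v)"

definition leaf :: "'a pair_pre_digraph \<Rightarrow> 'a \<Rightarrow> bool" where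
  "leaf G v \<longleftrightarrow> v \<in> pverts G \<and> degree G v = 1"

text \<open>
  The library predicate \<^const>\<open>tree\<close> is not usable here: in a symmetric digraph the walk
  \<open>u, v, u\<close> along a single edge is a \<^const>\<open>pre_digraph.cycle\<close>, of length 2. The cycles of the
  underlying simple graph are those of length at least 3.
\<close>

definition undirected_tree :: "'a pair_pre_digraph \<Rightarrow> bool" where
  "undirected_tree G \<longleftrightarrow> pair_graph G \<and> connected (with_proj G) \<and>
    \<not> (\<exists>p. pre_digraph.cycle (with_proj G) p \<and> length p \<ge> 3)"

definition open_twins :: "'a pair_pre_digraph \<Rightarrow> 'a \<Rightarrow> 'a \<Rightarrow> bool" where
  "open_twins G u v \<longleftrightarrow>
    u \<in> pverts G \<and> v \<in> pverts G \<and> u \<noteq> v \<and> nbhd G u = nbhd G v"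

definition dominating_set :: "'a pair_pre_digraph \<Rightarrow> 'a set \<Rightarrow> bool" where
  "dominating_set G D \<longleftrightarrow>
    D \<subseteq> pverts G \<and> (\<forall>v \<in> pverts G - D. \<exists>u \<in> D. u \<in> nbhd G v)"

definition locating_dominating_set :: "'a pair_pre_digraph \<Rightarrow> 'a set \<Rightarrow> bool" where
  "locating_dominating_set G D \<longleftrightarrow> dominating_set G D \<and>
    (\<forall>u \<in> pverts G - D. \<forall>v \<in> pverts G - D. u \<noteq> v \<longrightarrow> nbhd G u \<inter> D \<noteq> nbhd G v \<inter> D)"

definition location_domination_number :: "'a pair_pre_digraph \<Rightarrow> nat" where
  "location_domination_number G = Min (card ` {D. locating_dominating_set G D})"

text \<open>The minimum ranges over a finite nonempty set, so it is a genuine minimum.\<close>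

lemma
  assumes "pair_graph G"
  shows finite_locating_dominating_sets: "finite {D. locating_dominating_set G D}"
    and locating_dominating_set_pverts: "locating_dominating_set G (pverts G)"
proof -
  interpret pair_graph G by fact
  have "{D. locating_dominating_set G D} \<subseteq> Pow (pverts G)"
    by (auto simp: locating_dominating_set_def dominating_set_def)
  then show "finite {D. locating_dominating_set G D}"
    using pair_finite_verts finite_subset by blast
  show "locating_dominating_set G (pverts G)"
    by (simp add: locating_dominating_set_def dominating_set_def)
qed

definition perfect_matching :: "'a pair_pre_digraph \<Rightarrow> 'a set set \<Rightarrow> bool" where
  "perfect_matching G M \<longleftrightarrow> M \<subseteq> edges G \<and>
    (\<forall>e \<in> M. \<forall>f \<in> M. e \<noteq> f \<longrightarrow> e \<inter> f = {}) \<and> \<Union>M = pverts G"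

datatype color = Black | White

definition family_T :: "'a pair_pre_digraph set" where
  "family_T = {T. undirected_tree T \<and>
    (\<exists>M c. perfect_matching T M \<and>
      (\<forall>e \<in> M. \<exists>u v. e = {u, v} \<and> c u = White \<and> c v = Black) \<and>
      (\<forall>w \<in> pverts T. c w = White \<longrightarrow>
        leaf T w \<or>
        degree T w = 2 \<and>
        (\<exists>b \<in> nbhd T w. c b = Black \<and> (\<exists>l \<in> nbhd T b. c l = White \<and> leaf T l))))}"

end

theory Submission
  imports Defs
begin

text \<open>
  Without isolated vertices and open twins every vertex cover is locating-dominating. In a forest
  some vertex cover has the size of a matching, so \<open>\<gamma>\<^sub>L = n/2\<close> forces a perfect matching \<open>M\<close>.
  Let \<open>uv \<in> M\<close> join two non-leaves, and let \<open>D\<close> consist of the vertices that lie at odd distance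
  from \<open>u\<close> on the \<open>u\<close>-side of \<open>uv\<close>, or at odd distance from \<open>v\<close> on the \<open>v\<close>-side. Then \<open>D\<close> meets
  every other edge of \<open>M\<close> once, so it has \<open>n/2 - 1\<close> elements and is not locating-dominating. As
  \<open>uv\<close> is the only edge that \<open>D\<close> does not cover, this means that one end of \<open>uv\<close> has degree 2 and
  its other neighbor supports a leaf; that end is coloured white.
  Conversely, the black vertices form a vertex cover. If a locating-dominating set \<open>D\<close> misses an
  edge \<open>wb \<in> M\<close> with \<open>w\<close> white, then \<open>w\<close> is dominated only by a black vertex \<open>b'\<close> with a white
  leaf \<open>l\<close>, and separating \<open>w\<close> from \<open>l\<close> puts both \<open>b'\<close> and \<open>l\<close> into \<open>D\<close>. As \<open>b'\<close> determines \<open>w\<close>,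
  the edges missed by \<open>D\<close> are made up for by distinct edges contained in \<open>D\<close>.
\<close>

section \<open>Graphs all of whose edges are bridges\<close>

text \<open>For symmetric \<open>E\<close> this says that every edge is a bridge, so that
  \<open>E\<close> is a forest. The cut \<open>U\<close> replaces paths and cycles, and the property
  passes to subrelations, which allows induction on deleted edges.\<close>

definition bridged :: "'a rel \<Rightarrow> bool" where
  "bridged E \<longleftrightarrow> (\<forall>u v. (u, v) \<in> E \<longrightarrow>
    (\<exists>U. u \<in> U \<and> v \<notin> U \<and> (\<forall>x y. (x, y) \<in> E \<longrightarrow> x \<in> U \<longrightarrow> y \<notin> U \<longrightarrow> x = u \<and> y = v)))"

lemma bridgedE:
  assumes "bridged E" "(u, v) \<in> E"
  obtains U where "u \<in> U" "v \<notin> U"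
    "\<And>x y. (x, y) \<in> E \<Longrightarrow> x \<in> U \<Longrightarrow> y \<notin> U \<Longrightarrow> x = u \<and> y = v"
  using assms unfolding bridged_def by meson

lemma bridged_subset: "bridged E \<Longrightarrow> F \<subseteq> E \<Longrightarrow> bridged F"
  unfolding bridged_def by (meson subsetD)

lemma bridged_irrefl: "bridged E \<Longrightarrow> (u, v) \<in> E \<Longrightarrow> u \<noteq> v"
  by (auto elim: bridgedE)

text \<open>A forest has no 4-cycle: for \<open>x\<close> different from \<open>u\<close>, the
  detour \<open>u\<close>, \<open>z\<close>, \<open>x\<close>, \<open>y\<close> would leave
  \<open>U\<close> without using the bridge from \<open>u\<close> to \<open>y\<close>.\<close>

lemma bridged_common_nbr_unique:
  assumes "bridged E" "sym E" "(u, y) \<in> E" "(u, z) \<in> E" "(x, y) \<in> E" "(x, z) \<in> E" "y \<noteq> z"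
  shows "x = u"
proof -
  obtain U where U: "u \<in> U" "y \<notin> U"
      "\<And>a b. (a, b) \<in> E \<Longrightarrow> a \<in> U \<Longrightarrow> b \<notin> U \<Longrightarrow> a = u \<and> b = y"
    using bridgedE[OF assms(1,3)] by metis
  have "z \<in> U" using U(1,3) assms(4,7) by blast
  moreover have "(z, x) \<in> E" using assms(2,6) by (auto dest: symD)
  ultimately have "x \<in> U" using U(1,3) assms(3,5,7) bridged_irrefl[OF assms(1,4)] by blast
  then show ?thesis using U(2,3) assms(5) by blast
qed

text \<open>A leaf is found as the only vertex of an inclusion-minimal side of a bridge.\<close>

lemma bridged_leaf_exists:
  assumes "bridged E" "sym E" "finite E" "E \<noteq> {}"
  obtains l s where "(l, s) \<in> E" "\<And>y. (l, y) \<in> E \<Longrightarrow> y = s"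
proof -
  define side where "side u v U \<longleftrightarrow> (u, v) \<in> E \<and> u \<in> U \<and> v \<notin> U \<and>
    (\<forall>x y. (x, y) \<in> E \<longrightarrow> x \<in> U \<longrightarrow> y \<notin> U \<longrightarrow> x = u \<and> y = v)" for u v U
  define P where "P = (\<lambda>(u, v, U). side u v U)"
  \<comment> \<open>A side may be an infinite set; only its part inside the finite set
    \<open>Domain E\<close> is counted.\<close>
  define m where "m = (\<lambda>(u :: 'a, v :: 'a, U). card (U \<inter> Domain E))"
  have sideD: "(u, v) \<in> E" "u \<in> U" "v \<notin> U" if "side u v U" for u v U
    using that unfolding side_def by iprover+
  have cross: "x = u \<and> y = v"
    if "side u v U" "(x, y) \<in> E" "x \<in> U" "y \<notin> U" for u v U x y
    using that unfolding side_def by iprover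
  have ex_side: "\<exists>U. side u v U" if "(u, v) \<in> E" for u v
    using assms(1) that unfolding bridged_def side_def by simp
  obtain u0 v0 where "(u0, v0) \<in> E" using assms(4) by auto
  then obtain U0 where "P (u0, v0, U0)" using ex_side by (auto simp: P_def)
  then obtain t where t: "P t" "\<And>t'. P t' \<Longrightarrow> m t \<le> m t'"
    using ex_has_least_nat[of P _ m] by blast
  obtain u v U where [simp]: "t = (u, v, U)" by (cases t)
  have uv: "side u v U" using t(1) by (simp add: P_def)
  have "y = v" if y: "(u, y) \<in> E" for y
  proof (rule ccontr)
    assume "y \<noteq> v"
    then have "y \<in> U" using cross[OF uv y sideD(2)[OF uv]] by blast
    have yu: "(y, u) \<in> E" using assms(2) y by (rule symD)
    then obtain U' where U': "side y u U'" using ex_side by blast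
    \<comment> \<open>A second neighbour \<open>y\<close> of \<open>u\<close> gives a side that
      lacks \<open>u\<close> and hence is smaller than the minimal one.\<close>
    have "side y u (U \<inter> U')"
      unfolding side_def
    proof (intro conjI allI impI)
      show "(y, u) \<in> E" "y \<in> U \<inter> U'" "u \<notin> U \<inter> U'"
        using yu \<open>y \<in> U\<close> sideD[OF U'] by simp_all
      fix a b assume ab: "(a, b) \<in> E" "a \<in> U \<inter> U'" "b \<notin> U \<inter> U'"
      have "b \<in> U" using cross[OF uv ab(1)] ab(2) sideD(3)[OF U'] by blast
      then show "a = y" "b = u" using cross[OF U' ab(1)] ab(2,3) by simp_all
    qed
    then have "m t \<le> m (y, u, U \<inter> U')" using t(2) by (simp add: P_def)
    moreover have "(U \<inter> U') \<inter> Domain E \<subset> U \<inter> Domain E"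
      using sideD[OF uv] sideD[OF U'] by blast
    moreover have "finite (U \<inter> Domain E)" using assms(3) by (simp add: finite_Domain)
    ultimately show False using psubset_card_mono[of "U \<inter> Domain E" "(U \<inter> U') \<inter> Domain E"]
      by (simp add: m_def)
  qed
  then show ?thesis using that sideD(1)[OF uv] by blast
qed

text \<open>Delete an edge and 2-colour the rest by induction. If the ends of the deleted edge
  agree, flip all colours on one side of the bridge; no remaining edge crosses it.\<close>

lemma bridged_bipartite:
  assumes "finite E" "bridged E" "sym E"
  shows "\<exists>A. \<forall>x y. (x, y) \<in> E \<longrightarrow> (x \<in> A \<longleftrightarrow> y \<notin> A)"
  using assms
proof (induction E rule: finite_psubset_induct)
  case (psubset E)
  show ?case
  proof (cases "E = {}")
    case False
    then obtain u v where uv: "(u, v) \<in> E" by auto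
    define F where "F = E - {(u, v), (v, u)}"
    have "F \<subset> E" using uv by (auto simp: F_def)
    moreover have "sym F" using psubset.prems(2) by (auto simp: F_def sym_def)
    moreover have "bridged F" using psubset.prems(1) \<open>F \<subset> E\<close> bridged_subset by blast
    ultimately obtain A where A: "\<And>x y. (x, y) \<in> F \<Longrightarrow> x \<in> A \<longleftrightarrow> y \<notin> A"
      using psubset.IH by metis
    obtain U where U: "u \<in> U" "v \<notin> U"
        "\<And>x y. (x, y) \<in> E \<Longrightarrow> x \<in> U \<Longrightarrow> y \<notin> U \<Longrightarrow> x = u \<and> y = v"
      using bridgedE[OF psubset.prems(1) uv] by metis
    have cross: "x \<in> U \<longleftrightarrow> y \<in> U" if "(x, y) \<in> F" for x y
    proof -
      have "(x, y) \<in> E" "(y, x) \<in> E" "\<not> (x = u \<and> y = v)" "\<not> (y = u \<and> x = v)"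
        using that symD[OF psubset.prems(2)] unfolding F_def by blast+
      then show ?thesis using U(3)[of x y] U(3)[of y x] by blast
    qed
    show ?thesis
    proof (cases "u \<in> A \<longleftrightarrow> v \<notin> A")
      case True
      then have "\<forall>x y. (x, y) \<in> E \<longrightarrow> (x \<in> A \<longleftrightarrow> y \<notin> A)" using A by (auto simp: F_def)
      then show ?thesis by blast
    next
      case False
      \<comment> \<open>The symmetric difference of \<open>A\<close> and \<open>U\<close>, that is,
        the colouring flipped on \<open>U\<close>.\<close>
      define A' where "A' = {x. (x \<in> A) \<noteq> (x \<in> U)}"
      have "x \<in> A' \<longleftrightarrow> y \<notin> A'" if "(x, y) \<in> E" for x y
      proof (cases "(x, y) \<in> F")
        case True
        then show ?thesis using A cross by (auto simp: A'_def)
      next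
        case False
        then have "x = u \<and> y = v \<or> x = v \<and> y = u" using that by (auto simp: F_def)
        then show ?thesis using \<open>\<not> (u \<in> A \<longleftrightarrow> v \<notin> A)\<close> U(1,2) by (auto simp: A'_def)
      qed
      then show ?thesis by blast
    qed
  qed auto
qed

section \<open>Matchings and vertex covers\<close>

definition matching_on :: "'a rel \<Rightarrow> 'a set set \<Rightarrow> bool" where
  "matching_on E M \<longleftrightarrow> M \<subseteq> {{u, v} | u v. (u, v) \<in> E} \<and>
    (\<forall>e \<in> M. \<forall>f \<in> M. e \<noteq> f \<longrightarrow> e \<inter> f = {})"

lemma matching_onE:
  assumes "matching_on E M" "e \<in> M"
  obtains x y where "e = {x, y}" "(x, y) \<in> E"
proof -
  have "e \<in> {{u, v} | u v. (u, v) \<in> E}" using assms by (auto simp: matching_on_def)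
  then show ?thesis using that by blast
qed

lemma matching_on_unique:
  assumes "matching_on E M" "e \<in> M" "f \<in> M" "x \<in> e" "x \<in> f"
  shows "e = f"
proof (rule ccontr)
  assume "e \<noteq> f"
  then have "e \<inter> f = {}" using assms(1,2,3) by (simp add: matching_on_def)
  then show False using assms(4,5) by auto
qed

definition vertex_cover :: "'a rel \<Rightarrow> 'a set \<Rightarrow> bool" where
  "vertex_cover E C \<longleftrightarrow> (\<forall>x y. (x, y) \<in> E \<longrightarrow> x \<in> C \<or> y \<in> C)"

text \<open>The forest case of Konig's theorem, by a greedy induction: for a leaf \<open>l\<close>
  with neighbour \<open>s\<close>, put \<open>s\<close> into the cover and \<open>{l, s}\<close>
  into the matching, then delete all edges at \<open>s\<close>.\<close>

lemma bridged_matching_cover: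
  assumes "finite E" "bridged E" "sym E"
  shows "\<exists>C M. C \<subseteq> Domain E \<and> vertex_cover E C \<and> matching_on E M \<and> card C \<le> card M"
  using assms
proof (induction E rule: finite_psubset_induct)
  case (psubset E)
  show ?case
  proof (cases "E = {}")
    case True
    then show ?thesis by (intro exI[of _ "{}"]) (auto simp: vertex_cover_def matching_on_def)
  next
    case False
    obtain l s where ls: "(l, s) \<in> E" "\<And>y. (l, y) \<in> E \<Longrightarrow> y = s"
      using bridged_leaf_exists[OF psubset.prems psubset.hyps False] by metis
    define F where "F = {(x, y) \<in> E. x \<noteq> s \<and> y \<noteq> s}"
    have "F \<subset> E" using ls(1) by (auto simp: F_def)
    moreover have "sym F" using psubset.prems(2) by (auto simp: F_def sym_def)
    moreover have "bridged F" using psubset.prems(1) \<open>F \<subset> E\<close> bridged_subset by blast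
    ultimately obtain C M where CM: "C \<subseteq> Domain F" "vertex_cover F C" "matching_on F M"
        "card C \<le> card M"
      using psubset.IH by metis
    have M: "M \<subseteq> {{u, v} | u v. (u, v) \<in> F}" using CM(3) by (simp add: matching_on_def)
    have "finite F" using psubset.hyps \<open>F \<subset> E\<close> finite_subset by blast
    moreover have "{{u, v} | u v. (u, v) \<in> F} = (\<lambda>(u, v). {u, v}) ` F" by auto
    ultimately have "finite M" using M finite_subset by fastforce
    have avoid: "l \<notin> e" "s \<notin> e" if "e \<in> M" for e
    proof -
      obtain x y where xy: "e = {x, y}" "(x, y) \<in> F" using M \<open>e \<in> M\<close> by blast
      then have "(x, y) \<in> E" "(y, x) \<in> E" "x \<noteq> s" "y \<noteq> s"
        using psubset.prems(2) by (auto simp: F_def dest: symD)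
      then show "l \<notin> e" "s \<notin> e" using ls(2) xy(1) by auto
    qed
    have "insert s C \<subseteq> Domain E"
      using CM(1) ls(1) \<open>F \<subset> E\<close> symD[OF psubset.prems(2)] by blast
    moreover have "vertex_cover E (insert s C)"
      using CM(2) by (auto simp: vertex_cover_def F_def)
    moreover have "matching_on E (insert {l, s} M)"
      unfolding matching_on_def
    proof (intro conjI)
      show "insert {l, s} M \<subseteq> {{u, v} | u v. (u, v) \<in> E}"
        using M ls(1) \<open>F \<subset> E\<close> by blast
      show "\<forall>e \<in> insert {l, s} M. \<forall>f \<in> insert {l, s} M. e \<noteq> f \<longrightarrow> e \<inter> f = {}"
        using CM(3) avoid unfolding matching_on_def by auto
    qed
    moreover have "{l, s} \<notin> M" using avoid by blast
    then have "card (insert s C) \<le> card (insert {l, s} M)"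
      using CM(4) \<open>finite M\<close> card_insert_le_m1[of "Suc (card M)" C s] by simp
    ultimately show ?thesis by blast
  qed
qed

lemma card_matching_sum:
  assumes "finite M" "\<And>e f. e \<in> M \<Longrightarrow> f \<in> M \<Longrightarrow> e \<noteq> f \<Longrightarrow> e \<inter> f = {}" "X \<subseteq> \<Union>M" "finite X"
  shows "card X = (\<Sum>e\<in>M. card (X \<inter> e))"
proof -
  have "X = (\<Union>e\<in>M. X \<inter> e)" using assms(3) by auto
  moreover have "card (\<Union>e\<in>M. X \<inter> e) = (\<Sum>e\<in>M. card (X \<inter> e))"
    using assms by (intro card_UN_disjoint) blast+
  ultimately show ?thesis by simp
qed

section \<open>Trees\<close>

lemma (in pair_graph) sym_parcs: "sym (parcs G)"
  by (auto intro!: symI arcs_symmetric)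

lemma mem_nbhd: "pair_graph G \<Longrightarrow> u \<in> nbhd G v \<longleftrightarrow> (v, u) \<in> parcs G"
  unfolding nbhd_def pair_graph_def pair_digraph_def pair_fin_digraph_def
  by (auto dest: pair_wf_digraph.in_arcsD2)

text \<open>As the side of \<open>(u, v)\<close> serves the set of vertices reachable from
  \<open>u\<close> without using the edge in either direction. A walk of this kind to
  \<open>v\<close> would close up to a cycle.\<close>

lemma undirected_tree_bridged:
  assumes "undirected_tree T"
  shows "bridged (parcs T)"
  unfolding bridged_def
proof (intro allI impI)
  fix u v assume uv: "(u, v) \<in> parcs T"
  interpret pair_graph T using assms by (simp add: undirected_tree_def)
  have vu: "(v, u) \<in> parcs T" using uv arcs_symmetric by blast
  define U where "U = {x. \<exists>p. awalk u p x \<and> (u, v) \<notin> set p \<and> (v, u) \<notin> set p}"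
  have "awalk u [] u" using uv in_arcsD1 by (auto simp: awalk_Nil_iff)
  then have "u \<in> U" unfolding U_def by force
  moreover have "v \<notin> U"
  proof
    assume "v \<in> U"
    then obtain p where p: "awalk u p v" "(u, v) \<notin> set p" unfolding U_def by auto
    define q where "q = awalk_to_apath p"
    have q: "apath u q v" unfolding q_def using p(1) by (rule apath_awalk_to_apath)
    have nuv: "(u, v) \<notin> set q" using awalk_to_apath_subset[OF p(1)] p(2) by (auto simp: q_def)
    have "u \<noteq> v" using uv no_loops' by blast
    \<comment> \<open>Only a path with at least two arcs closes to a cycle of length at least 3, as
      excluded by \<open>undirected_tree\<close>.\<close>
    have "length q \<ge> 2"
    proof (rule ccontr)
      assume "\<not> length q \<ge> 2"
      then consider "q = []" | a where "q = [a]"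
        by (cases q) (auto simp: numeral_2_eq_2 not_le less_Suc_eq_le)
      then show False
      proof cases
        case 1
        then show False using q \<open>u \<noteq> v\<close> by (auto simp: apath_Nil_iff)
      next
        case 2
        then have "a = (u, v)" using q by (cases a) (auto simp: apath_simps)
        then show False using 2 nuv by simp
      qed
    qed
    moreover have "cycle ((v, u) # q)"
      unfolding cycle_def
      using q vu in_arcsD1 by (intro exI[of _ v]) (auto simp: apath_def awalk_Cons_iff)
    ultimately show False
      using assms unfolding undirected_tree_def by (metis Suc_le_mono length_Cons numeral_2_eq_2 numeral_3_eq_3)
  qed
  moreover have "x = u \<and> y = v" if "(x, y) \<in> parcs T" "x \<in> U" "y \<notin> U" for x y
  proof (rule ccontr)
    assume neq: "\<not> (x = u \<and> y = v)"
    obtain p where p: "awalk u p x" "(u, v) \<notin> set p" "(v, u) \<notin> set p"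
      using \<open>x \<in> U\<close> unfolding U_def by auto
    have "awalk x [(x, y)] y" using that(1) in_arcsD2 by (auto simp: awalk_simps)
    then have "awalk u (p @ [(x, y)]) y" using p(1) by (rule awalk_appendI[rotated])
    moreover have "(u, v) \<notin> set (p @ [(x, y)])" "(v, u) \<notin> set (p @ [(x, y)])"
      using p(2,3) neq that(3) \<open>u \<in> U\<close> by auto
    ultimately show False using \<open>y \<notin> U\<close> unfolding U_def by blast
  qed
  ultimately show "\<exists>U. u \<in> U \<and> v \<notin> U \<and>
      (\<forall>x y. (x, y) \<in> parcs T \<longrightarrow> x \<in> U \<longrightarrow> y \<notin> U \<longrightarrow> x = u \<and> y = v)"
    by blast
qed

lemma undirected_tree_nbhd_nonempty:
  assumes "undirected_tree T" "card (pverts T) \<ge> 2" "v \<in> pverts T"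
  shows "nbhd T v \<noteq> {}"
proof -
  interpret pair_graph T using assms(1) by (simp add: undirected_tree_def)
  have "\<not> pverts T \<subseteq> {v}" using assms(2) card_mono[of "{v}" "pverts T"] by auto
  then obtain w where w: "w \<in> pverts T" "w \<noteq> v" by auto
  have "strongly_connected (with_proj T)"
    using assms(1) symmetric_connected_imp_strongly_connected[OF sym_arcs]
    by (simp add: undirected_tree_def)
  then have "v \<rightarrow>\<^sup>*\<^bsub>with_proj T\<^esub> w" using w assms(3) by (auto elim: strongly_connectedE)
  then obtain p where "awalk v p w" by (auto simp: reachable_awalk)
  then obtain x where "(v, x) \<in> parcs T"
    using w(2) by (cases p) (auto simp: awalk_simps)
  then show ?thesis using mem_nbhd[OF pair_graph] by blast
qed

section \<open>Locating-dominating sets\<close>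

lemma location_domination_number_le:
  assumes "pair_graph T" "locating_dominating_set T D"
  shows "location_domination_number T \<le> card D"
  unfolding location_domination_number_def
  using assms by (intro Min_le) (auto simp: finite_locating_dominating_sets)

lemma location_domination_number_attained:
  assumes "pair_graph T"
  obtains D where "locating_dominating_set T D" "card D = location_domination_number T"
proof -
  have "location_domination_number T \<in> card ` {D. locating_dominating_set T D}"
    unfolding location_domination_number_def
    using assms locating_dominating_set_pverts finite_locating_dominating_sets
    by (intro Min_in) auto
  then show ?thesis using that by auto
qed

text \<open>A vertex outside a cover has its whole neighbourhood inside it. Domination then amounts
  to the absence of isolated vertices, and location to the absence of open twins.\<close>

lemma vertex_cover_locating_dominating:
  assumes "pair_graph T" "\<And>v. v \<in> pverts T \<Longrightarrow> nbhd T v \<noteq> {}" "\<not> (\<exists>u v. open_twins T u v)"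
    and "C \<subseteq> pverts T" "vertex_cover (parcs T) C"
  shows "locating_dominating_set T C"
proof -
  have sub: "nbhd T v \<inter> C = nbhd T v" if "v \<notin> C" for v
    using that assms(5) mem_nbhd[OF assms(1)] unfolding vertex_cover_def by blast
  have "nbhd T u \<noteq> nbhd T v" if "u \<in> pverts T" "v \<in> pverts T" "u \<noteq> v" for u v
    using that assms(3) unfolding open_twins_def by blast
  then have "nbhd T u \<inter> C \<noteq> nbhd T v \<inter> C" if "u \<in> pverts T - C" "v \<in> pverts T - C" "u \<noteq> v" for u v
    using that sub[of u] sub[of v] by simp
  moreover have "\<exists>u \<in> C. u \<in> nbhd T v" if "v \<in> pverts T - C" for v
    using that sub[of v] assms(2)[of v] by blast
  ultimately show ?thesis
    using assms(4) unfolding locating_dominating_set_def dominating_set_def by blast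
qed

lemma perfect_matching_matching_on:
  "perfect_matching T M \<longleftrightarrow> matching_on (parcs T) M \<and> \<Union>M = pverts T"
  by (auto simp: perfect_matching_def matching_on_def edges_def)

lemma matching_on_finite:
  assumes "finite E" "matching_on E M"
  shows "finite M"
proof -
  have "M \<subseteq> (\<lambda>(u, v). {u, v}) ` E" using assms(2) by (auto simp: matching_on_def)
  then show ?thesis using assms(1) finite_subset by blast
qed

lemma matching_on_card_Union:
  assumes "finite E" "matching_on E M" "irrefl E"
  shows "card (\<Union>M) = 2 * card M"
proof -
  have card2: "card e = 2" if "e \<in> M" for e
  proof -
    obtain x y where "e = {x, y}" "(x, y) \<in> E" by (rule matching_onE[OF assms(2) \<open>e \<in> M\<close>])
    moreover have "x \<noteq> y" using calculation assms(3) unfolding irrefl_def by blast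
    ultimately show ?thesis by simp
  qed
  have "pairwise disjnt M"
    using matching_on_unique[OF assms(2)] unfolding pairwise_def disjnt_def by blast
  moreover have "finite e" if "e \<in> M" for e using card2[OF that] card_ge_0_finite by force
  ultimately have "card (\<Union>M) = (\<Sum>e\<in>M. card e)" by (rule card_Union_disjoint)
  then show ?thesis using card2 by simp
qed

section \<open>From half the order to the family\<close>

text \<open>Once \<open>v\<close> is disregarded, \<open>u\<close> and the leaf \<open>x\<close>
  both see only \<open>y\<close>. This is the obstruction to locating \<open>u\<close> by a set that
  leaves the edge \<open>uv\<close> uncovered.\<close>

definition support_leaf_end :: "'a pair_pre_digraph \<Rightarrow> 'a \<Rightarrow> 'a \<Rightarrow> bool" where
  "support_leaf_end T u v \<longleftrightarrow>
    (\<exists>y x. y \<noteq> v \<and> nbhd T u = {v, y} \<and> x \<in> pverts T \<and> x \<noteq> u \<and> nbhd T x = {y})"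


text \<open>If neither end has this shape, a set with one vertex fewer than \<open>M\<close> has
  edges is locating-dominating, against \<open>min\<close>. It covers every edge but
  \<open>uv\<close>, so only \<open>u\<close> and \<open>v\<close> need special treatment.\<close>

lemma matching_edge_support_leaf_end:
  assumes T: "undirected_tree T" and noniso: "\<And>v. v \<in> pverts T \<Longrightarrow> nbhd T v \<noteq> {}"
    and notwins: "\<not> (\<exists>u v. open_twins T u v)"
    and M: "perfect_matching T M" "{u, v} \<in> M" and uv: "(u, v) \<in> parcs T"
    and nonleaf: "nbhd T u \<noteq> {v}" "nbhd T v \<noteq> {u}"
    and min: "\<And>D. locating_dominating_set T D \<Longrightarrow> card M \<le> card D"
  shows "support_leaf_end T u v \<or> support_leaf_end T v u"
proof (rule ccontr)
  assume no_end: "\<not> (support_leaf_end T u v \<or> support_leaf_end T v u)"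
  interpret pair_graph T using T by (simp add: undirected_tree_def)
  note mem = mem_nbhd[OF pair_graph]
  have E: "bridged (parcs T)" "sym (parcs T)" "finite (parcs T)"
    using undirected_tree_bridged[OF T] sym_parcs pair_finite_arcs by auto
  have vu: "(v, u) \<in> parcs T" using uv arcs_symmetric by blast
  obtain A where A: "\<And>x y. (x, y) \<in> parcs T \<Longrightarrow> x \<in> A \<longleftrightarrow> y \<notin> A"
    using bridged_bipartite[OF E(3,1,2)] by metis
  obtain U where U: "u \<in> U" "v \<notin> U"
      "\<And>x y. (x, y) \<in> parcs T \<Longrightarrow> x \<in> U \<Longrightarrow> y \<notin> U \<Longrightarrow> x = u \<and> y = v"
    using bridgedE[OF E(1) uv] by metis
  have cross: "x \<in> U \<longleftrightarrow> y \<in> U" if "(x, y) \<in> parcs T" "{x, y} \<noteq> {u, v}" for x y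
    using that U(3)[of x y] U(3)[of y x] arcs_symmetric by (metis insert_commute)
  \<comment> \<open>The parity of the distance is read off the 2-colouring; \<open>u\<close> and \<open>v\<close> have different colours.\<close>
  define D where "D = {x \<in> pverts T. (x \<in> U) \<noteq> ((x \<in> A) = (u \<in> A))}"
  have uvD: "u \<notin> D" "v \<notin> D" using U(1,2) A[OF uv] by (auto simp: D_def)
  have one: "x \<in> D \<longleftrightarrow> y \<notin> D" if "(x, y) \<in> parcs T" "{x, y} \<noteq> {u, v}" for x y
    using cross[OF that] A[OF that(1)] in_arcsD1[OF that(1)] in_arcsD2[OF that(1)]
    by (auto simp: D_def)

  have "card D < card M"
  proof -
    have fin: "finite M" using matching_on_finite[OF E(3)] M(1)
      by (simp add: perfect_matching_matching_on)
    have "card (D \<inter> e) = (if e = {u, v} then 0 else 1)" if "e \<in> M" for e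
    proof (cases "e = {u, v}")
      case True
      then show ?thesis using uvD by simp
    next
      case False
      obtain x y where xy: "e = {x, y}" "(x, y) \<in> parcs T"
        using M(1) \<open>e \<in> M\<close> unfolding perfect_matching_matching_on by (elim conjE matching_onE)
      then have "D \<inter> e = {x} \<or> D \<inter> e = {y}" using one[of x y] False by auto
      then have "card (D \<inter> e) = 1" by (elim disjE) simp_all
      then show ?thesis using False by simp
    qed
    moreover have "card D = (\<Sum>e\<in>M. card (D \<inter> e))"
      using M(1) fin pair_finite_verts
      by (intro card_matching_sum) (auto simp: perfect_matching_def D_def)
    ultimately have "card D = (\<Sum>e\<in>M. if e = {u, v} then 0 else 1)" by simp
    also have "\<dots> = (\<Sum>e\<in>M - {{u, v}}. 1)"
      using fin by (intro sum.mono_neutral_cong_right) auto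
    also have "\<dots> < card M" using card_Diff1_less[OF fin M(2)] by simp
    finally show ?thesis .
  qed
  moreover have "locating_dominating_set T D"
  proof -
    \<comment> \<open>Outside \<open>D\<close>, every vertex except \<open>u\<close> and
      \<open>v\<close> keeps its whole neighbourhood in view.\<close>
    have full: "nbhd T x \<inter> D = nbhd T x" if "x \<notin> D" "x \<noteq> u" "x \<noteq> v" for x
      using one[of x] that by (auto simp: mem doubleton_eq_iff)
    have nbD: "nbhd T u \<inter> D = nbhd T u - {v}" "nbhd T v \<inter> D = nbhd T v - {u}"
      using one[of u] one[of v] uvD bridged_irrefl[OF E(1)]
      by (auto simp: mem doubleton_eq_iff)
    have ne: "nbhd T u - {v} \<noteq> {}" "nbhd T v - {u} \<noteq> {}"
      using nonleaf uv vu mem by blast+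
    \<comment> \<open>Suppose \<open>x\<close> sees exactly what is left for \<open>s\<close>. If
      that is a single vertex, \<open>x\<close> is a leaf and \<open>s\<close> has the excluded
      shape; if there are two, they form a 4-cycle with \<open>s\<close> and
      \<open>x\<close>.\<close>
    have differ: "nbhd T s - {t} \<noteq> nbhd T x"
      if st: "s = u \<and> t = v \<or> s = v \<and> t = u" and x: "x \<in> pverts T" "x \<noteq> u" "x \<noteq> v" for s t x
    proof
      assume eq: "nbhd T s - {t} = nbhd T x"
      obtain y where y: "y \<in> nbhd T s" "y \<noteq> t" using ne st by blast
      show False
      proof (cases "nbhd T x = {y}")
        case True
        have "t \<in> nbhd T s" using st uv vu mem by auto
        then have "nbhd T s = {t, y}" using True eq by blast
        then have "support_leaf_end T s t"
          using True y(2) x st unfolding support_leaf_end_def by blast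
        then show False using no_end st by blast
      next
        case False
        then obtain z where "z \<in> nbhd T x" "z \<noteq> y" using y eq by blast
        moreover have "z \<in> nbhd T s" "y \<in> nbhd T x" using eq y calculation by blast+
        ultimately have "x = s"
          using bridged_common_nbr_unique[OF E(1,2), of s y z x] y(1) by (auto simp: mem)
        then show False using st x by blast
      qed
    qed
    have "nbhd T u \<inter> D \<noteq> nbhd T v \<inter> D"
    proof -
      \<comment> \<open>The adjacent vertices \<open>u\<close> and \<open>v\<close> lie in different
        colour classes and so share no neighbour; their traces on \<open>D\<close> are disjoint and
        nonempty.\<close>
      have "nbhd T u \<inter> nbhd T v = {}" using A A[OF uv] by (auto simp: mem)
      then show ?thesis using ne nbD by blast
    qed
    moreover have "nbhd T x \<noteq> nbhd T y" if "x \<in> pverts T" "y \<in> pverts T" "x \<noteq> y" for x y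
      using that notwins by (auto simp: open_twins_def)
    ultimately have "nbhd T x \<inter> D \<noteq> nbhd T y \<inter> D"
      if "x \<in> pverts T - D" "y \<in> pverts T - D" "x \<noteq> y" for x y
      using that nbD full[of x] full[of y] differ[of u v x] differ[of v u x]
        differ[of u v y] differ[of v u y]
      by (cases "x = u"; cases "x = v"; cases "y = u"; cases "y = v") auto
    moreover have "nbhd T x \<inter> D \<noteq> {}" if "x \<in> pverts T - D" for x
      using that nbD ne full[of x] noniso[of x] by (cases "x = u"; cases "x = v") auto
    ultimately show ?thesis
      unfolding locating_dominating_set_def dominating_set_def by (auto simp: D_def)
  qed
  ultimately show False using min by fastforce
qed

lemma leaf_iff_nbhd: "leaf T v \<longleftrightarrow> v \<in> pverts T \<and> (\<exists>u. nbhd T v = {u})"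
  by (auto simp: leaf_def degree_def card_1_singleton_iff)

lemma half_location_domination_imp_family_T:
  assumes T: "undirected_tree T" and n: "card (pverts T) \<ge> 2"
    and notwins: "\<not> (\<exists>u v. open_twins T u v)"
    and half: "2 * location_domination_number T = card (pverts T)"
  shows "T \<in> family_T"
proof -
  interpret pair_graph T using T by (simp add: undirected_tree_def)
  note mem = mem_nbhd[OF pair_graph]
  note noniso = undirected_tree_nbhd_nonempty[OF T n]
  have E: "bridged (parcs T)" "sym (parcs T)" "finite (parcs T)"
    using undirected_tree_bridged[OF T] sym_parcs pair_finite_arcs by auto
  have irr: "irrefl (parcs T)" using bridged_irrefl[OF E(1)] by (auto simp: irrefl_def)
  obtain C M where CM: "C \<subseteq> Domain (parcs T)" "vertex_cover (parcs T) C"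
      "matching_on (parcs T) M" "card C \<le> card M"
    using bridged_matching_cover[OF E(3,1,2)] by blast
  have "C \<subseteq> pverts T" using CM(1) in_arcsD1 by auto
  then have "locating_dominating_set T C"
    using vertex_cover_locating_dominating[OF pair_graph noniso notwins _ CM(2)] by blast
  then have le: "location_domination_number T \<le> card M"
    using location_domination_number_le[OF pair_graph] CM(4) le_trans by blast
  have Msub: "\<Union>M \<subseteq> pverts T"
  proof
    fix x assume "x \<in> \<Union>M"
    then obtain e where "e \<in> M" "x \<in> e" by blast
    moreover from this obtain a b where "e = {a, b}" "(a, b) \<in> parcs T"
      by (elim matching_onE[OF CM(3)])
    ultimately show "x \<in> pverts T" using in_arcsD1 in_arcsD2 by auto
  qed
  have "card (\<Union>M) = 2 * card M" by (rule matching_on_card_Union[OF E(3) CM(3) irr])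
  \<comment> \<open>The order is twice \<open>location_domination_number T\<close>, hence at most
    \<open>2 * card M = card (\<Union>M)\<close>, which is at most the order again. Equality holds
    throughout.\<close>
  then have cardM: "card (pverts T) = 2 * card M" and "\<Union>M = pverts T"
    using le half card_mono[OF pair_finite_verts Msub] card_seteq[OF pair_finite_verts Msub]
    by auto
  then have pm: "perfect_matching T M" using CM(3) by (simp add: perfect_matching_matching_on)
  have min: "card M \<le> card D" if "locating_dominating_set T D" for D
    using location_domination_number_le[OF pair_graph that] half cardM by simp

  \<comment> \<open>The end of \<open>e\<close> to be coloured white: a leaf whenever
    \<open>e\<close> contains one, otherwise an end supplied by the preceding lemma.\<close>
  define white_end where "white_end e w \<longleftrightarrow> w \<in> e \<and>
    (leaf T w \<or> (\<forall>x \<in> e. \<not> leaf T x) \<and> (\<exists>v. support_leaf_end T w v))" for e w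
  have "\<exists>w. white_end e w" if "e \<in> M" for e
  proof -
    obtain u v where e: "e = {u, v}" "(u, v) \<in> parcs T"
      by (rule matching_onE[OF CM(3) \<open>e \<in> M\<close>])
    show ?thesis
    proof (cases "\<exists>x \<in> e. leaf T x")
      case True
      then show ?thesis unfolding white_end_def by blast
    next
      case False
      then have "nbhd T u \<noteq> {v}" "nbhd T v \<noteq> {u}"
        using e in_arcsD1 in_arcsD2 leaf_iff_nbhd by (metis insertCI)+
      then have "support_leaf_end T u v \<or> support_leaf_end T v u"
        using matching_edge_support_leaf_end[OF T noniso notwins pm _ e(2) _ _ min] e(1) \<open>e \<in> M\<close>
        by blast
      then show ?thesis using False e(1) unfolding white_end_def by blast
    qed
  qed
  then obtain w where w: "\<And>e. e \<in> M \<Longrightarrow> white_end e (w e)" by metis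
  define c where "c x = (if x \<in> w ` M then White else Black)" for x
  have w_unique: "w f = w e" if "e \<in> M" "f \<in> M" "w f \<in> e" for e f
  proof -
    have "w f \<in> f" using w[OF that(2)] by (simp add: white_end_def)
    then have "e = f" using matching_on_unique[OF CM(3)] that by blast
    then show ?thesis by simp
  qed
  have c_iff: "c x = White \<longleftrightarrow> x = w e" if "e \<in> M" "x \<in> e" for e x
  proof
    assume "c x = White"
    then obtain f where "f \<in> M" "x = w f" by (auto simp: c_def split: if_splits)
    then show "x = w e" using w_unique that by blast
  next
    assume "x = w e"
    then show "c x = White" using that(1) by (simp add: c_def)
  qed
  have c_Black: "c x = Black" if "e \<in> M" "x \<in> e" "x \<noteq> w e" for e x
    using c_iff[OF that(1,2)] that(3) by (cases "c x") auto
  have ends: "\<exists>u v. e = {u, v} \<and> c u = White \<and> c v = Black" if "e \<in> M" for e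
  proof -
    obtain x y where e: "e = {x, y}" "(x, y) \<in> parcs T"
      by (rule matching_onE[OF CM(3) \<open>e \<in> M\<close>])
    have "x \<noteq> y" using bridged_irrefl[OF E(1) e(2)] .
    have "w e = x \<or> w e = y" using w[OF that] e(1) unfolding white_end_def by blast
    then obtain v where v: "e = {w e, v}" "v \<noteq> w e" using e(1) \<open>x \<noteq> y\<close> by blast
    then have "w e \<in> e" "v \<in> e" by blast+
    then show ?thesis using c_iff[OF that] c_Black[OF that] v by blast
  qed
  have cond: "leaf T z \<or> degree T z = 2 \<and>
      (\<exists>b \<in> nbhd T z. c b = Black \<and> (\<exists>l \<in> nbhd T b. c l = White \<and> leaf T l))"
    if z: "z \<in> pverts T" "c z = White" for z
  proof (cases "leaf T z")
    case False
    obtain e where e: "e \<in> M" "z = w e" using z(2) by (auto simp: c_def split: if_splits)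
    then obtain v where "support_leaf_end T z v"
      using w[OF e(1)] False unfolding white_end_def by blast
    then obtain y x where yx: "y \<noteq> v" "nbhd T z = {v, y}" "x \<in> pverts T" "x \<noteq> z" "nbhd T x = {y}"
      unfolding support_leaf_end_def by blast
    have x: "leaf T x" using yx by (auto simp: leaf_iff_nbhd)
    have y: "z \<in> nbhd T y" "x \<in> nbhd T y" using yx arcs_symmetric mem by blast+
    \<comment> \<open>\<open>y\<close> has the two neighbours \<open>z\<close> and \<open>x\<close>.
      The matching edge at the leaf \<open>x\<close> must be \<open>{x, y}\<close>, and since
      \<open>y\<close> is no leaf, \<open>x\<close> is its white end.\<close>
    then have "\<not> leaf T y" using yx(4) by (auto simp: leaf_iff_nbhd)
    obtain f where f: "f \<in> M" "x \<in> f" using \<open>\<Union>M = pverts T\<close> yx(3) by blast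
    obtain x1 x2 where f12: "f = {x1, x2}" "(x1, x2) \<in> parcs T"
      by (rule matching_onE[OF CM(3) f(1)])
    then have "x2 \<in> nbhd T x1" "x1 \<in> nbhd T x2" using arcs_symmetric mem by auto
    then have "f = {x, y}" using f(2) f12(1) yx(5) by auto
    then have "w f = x" using w[OF f(1)] x \<open>\<not> leaf T y\<close> unfolding white_end_def by auto
    moreover have "x \<noteq> y" using x \<open>\<not> leaf T y\<close> by blast
    ultimately have "c x = White" "c y = Black"
      using c_iff[OF f(1), of x] c_Black[OF f(1), of y] \<open>f = {x, y}\<close> by auto
    moreover have "degree T z = 2" using yx(1,2) by (simp add: degree_def)
    ultimately show ?thesis using x y yx(2) by blast
  qed simp
  show ?thesis
    unfolding family_T_def mem_Collect_eq
    by (intro conjI T exI[of _ M] exI[of _ c] pm ballI impI ends cond)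
qed

section \<open>From the family to half the order\<close>

lemma family_T_imp_half_location_domination:
  assumes noniso: "\<And>v. v \<in> pverts T \<Longrightarrow> nbhd T v \<noteq> {}"
    and notwins: "\<not> (\<exists>u v. open_twins T u v)"
    and T: "T \<in> family_T"
  shows "2 * location_domination_number T = card (pverts T)"
proof -
  obtain M c where tree: "undirected_tree T" and pm: "perfect_matching T M"
    and ends': "\<forall>e \<in> M. \<exists>u v. e = {u, v} \<and> c u = White \<and> c v = Black"
    and cond': "\<forall>w \<in> pverts T. c w = White \<longrightarrow> leaf T w \<or> degree T w = 2 \<and>
      (\<exists>b \<in> nbhd T w. c b = Black \<and> (\<exists>l \<in> nbhd T b. c l = White \<and> leaf T l))"
    using T unfolding family_T_def mem_Collect_eq by (elim conjE exE) (rule that)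
  note ends = bspec[OF ends'] and cond = cond'[rule_format]
  interpret pair_graph T using tree by (simp add: undirected_tree_def)
  note mem = mem_nbhd[OF pair_graph]
  have M: "matching_on (parcs T) M" "\<Union>M = pverts T"
    using pm by (auto simp: perfect_matching_matching_on)
  have fin: "finite M" using matching_on_finite[OF pair_finite_arcs M(1)] .
  have irr: "irrefl (parcs T)" using no_loops' by (auto simp: irrefl_def)
  have cardM: "card (pverts T) = 2 * card M"
    using matching_on_card_Union[OF pair_finite_arcs M(1) irr] M(2) by simp
  define W where "W = {x \<in> pverts T. c x = White}"
  have "card W = (\<Sum>e\<in>M. card (W \<inter> e))"
    using M fin pair_finite_verts by (intro card_matching_sum) (auto simp: matching_on_def W_def)
  moreover have "card (W \<inter> e) = 1" if "e \<in> M" for e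
  proof -
    obtain x y where e: "e = {x, y}" "c x = White" "c y = Black" using ends[OF \<open>e \<in> M\<close>] by blast
    then have "W \<inter> e = {x}" using M(2) \<open>e \<in> M\<close> by (auto simp: W_def)
    then show ?thesis by simp
  qed
  ultimately have cardW: "card W = card M" by simp

  have "\<exists>b. {x, b} \<in> M \<and> c b = Black" if "x \<in> W" for x
  proof -
    obtain e where e: "e \<in> M" "x \<in> e" using M(2) \<open>x \<in> W\<close> by (auto simp: W_def)
    then obtain u v where "e = {u, v}" "c u = White" "c v = Black" using ends by blast
    then show ?thesis using e \<open>x \<in> W\<close> by (auto simp: W_def)
  qed
  then obtain p where p: "\<And>x. x \<in> W \<Longrightarrow> {x, p x} \<in> M" "\<And>x. x \<in> W \<Longrightarrow> c (p x) = Black" by metis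
  have p_nb: "p x \<in> nbhd T x" if "x \<in> W" for x
  proof -
    obtain a b where "{x, p x} = {a, b}" "(a, b) \<in> parcs T"
      by (rule matching_onE[OF M(1) p(1)[OF \<open>x \<in> W\<close>]])
    then show ?thesis using arcs_symmetric by (auto simp: mem doubleton_eq_iff)
  qed
  have p_inj: "x = y" if "x \<in> W" "y \<in> W" "p x = p y" for x y
  proof -
    have "{x, p x} = {y, p y}"
      using matching_on_unique[OF M(1) p(1)[OF that(1)] p(1)[OF that(2)], of "p x"] that(3) by simp
    then show ?thesis using that(3) by (auto simp: doubleton_eq_iff)
  qed
  have leaf_nb: "nbhd T x = {p x}" if "x \<in> W" "leaf T x" for x
    using p_nb[OF that(1)] that(2) by (auto simp: leaf_iff_nbhd)
  \<comment> \<open>Condition (ii) in terms of the matching: the black neighbour that carries the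
    leaf \<open>l\<close> is the partner \<open>p l\<close>, because a leaf has no other neighbour.
    It differs from \<open>p x\<close> by \<open>p_inj\<close>, so degree 2 determines the
    neighbourhood of \<open>x\<close>.\<close>
  have inner: "\<exists>l \<in> W. nbhd T l = {p l} \<and> nbhd T x = {p x, p l} \<and> l \<noteq> x"
    if x: "x \<in> W" "\<not> leaf T x" for x
  proof -
    obtain b l where bl: "degree T x = 2" "b \<in> nbhd T x" "l \<in> nbhd T b" "c l = White" "leaf T l"
      using cond[of x] x by (auto simp: W_def)
    have "l \<in> W" using bl by (auto simp: W_def leaf_def)
    then have l: "nbhd T l = {p l}" using leaf_nb bl(5) by blast
    moreover have "b \<in> nbhd T l" using bl(3) arcs_symmetric[of b l] by (simp add: mem)
    ultimately have "p l = b" by simp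
    have "l \<noteq> x" using bl(5) x(2) by blast
    then have "p l \<noteq> p x" using p_inj x(1) \<open>l \<in> W\<close> by blast
    then have "nbhd T x = {p x, p l}"
      using bl(1,2) \<open>p l = b\<close> p_nb[OF x(1)] by (auto simp: degree_def card_2_iff)
    then show ?thesis using l \<open>l \<in> W\<close> \<open>l \<noteq> x\<close> by blast
  qed

  \<comment> \<open>White vertices have only black neighbours, so the black vertices form a cover,
    of size \<open>card M\<close>.\<close>
  have "vertex_cover (parcs T) (pverts T - W)"
    unfolding vertex_cover_def
  proof (intro allI impI)
    fix x y assume xy: "(x, y) \<in> parcs T"
    have "c y = Black" if "x \<in> W"
      using that xy leaf_nb[of x] inner[of x] p(2) mem[of y x] by (cases "leaf T x") auto
    then show "x \<in> pverts T - W \<or> y \<in> pverts T - W"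
      using in_arcsD1[OF xy] in_arcsD2[OF xy] by (auto simp: W_def)
  qed
  then have "locating_dominating_set T (pverts T - W)"
    by (intro vertex_cover_locating_dominating[OF pair_graph noniso notwins]) auto
  then have "location_domination_number T \<le> card (pverts T - W)"
    by (rule location_domination_number_le[OF pair_graph])
  also have "\<dots> = card (pverts T) - card W"
    using pair_finite_verts by (intro card_Diff_subset) (auto simp: W_def)
  finally have upper: "location_domination_number T \<le> card M" using cardM cardW by simp

  obtain D where D: "locating_dominating_set T D" "card D = location_domination_number T"
    using location_domination_number_attained[OF pair_graph] by blast
  have dom: "nbhd T x \<inter> D \<noteq> {}" if "x \<in> pverts T" "x \<notin> D" for x
    using that D(1) by (auto simp: locating_dominating_set_def dominating_set_def)
  have loc: "x = y"
    if "x \<in> pverts T" "x \<notin> D" "y \<in> pverts T" "y \<notin> D" "nbhd T x \<inter> D = nbhd T y \<inter> D" for x y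
    using that D(1) by (auto simp: locating_dominating_set_def)
  have "finite D"
    using D(1) finite_subset[OF _ pair_finite_verts]
    by (auto simp: locating_dominating_set_def dominating_set_def)
  have missed: "\<exists>l \<in> W. l \<in> D \<and> p l \<in> D \<and> nbhd T x \<inter> D = {p l}"
    if x: "x \<in> W" "x \<notin> D" "p x \<notin> D" for x
  proof -
    have xV: "x \<in> pverts T" using x(1) by (simp add: W_def)
    have "\<not> leaf T x" using leaf_nb[OF x(1)] dom[OF xV x(2)] x(3) by auto
    then obtain l where l: "l \<in> W" "nbhd T l = {p l}" "nbhd T x = {p x, p l}" "l \<noteq> x"
      using inner x(1) by blast
    have "p l \<in> D" using dom[OF xV x(2)] l(3) x(3) by auto
    \<comment> \<open>Otherwise \<open>x\<close> and \<open>l\<close> would both lie outside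
      \<open>D\<close> with the same trace \<open>{p l}\<close>.\<close>
    moreover have "l \<in> D"
    proof (rule ccontr)
      assume "l \<notin> D"
      moreover have "nbhd T l \<inter> D = nbhd T x \<inter> D" using l x(3) \<open>p l \<in> D\<close> by auto
      ultimately show False using loc[of l x] l(1,4) x(2) xV by (auto simp: W_def)
    qed
    ultimately show ?thesis using l x(3) by auto
  qed
  then obtain q where q: "\<And>x. x \<in> W \<Longrightarrow> x \<notin> D \<Longrightarrow> p x \<notin> D \<Longrightarrow>
      q x \<in> W \<and> q x \<in> D \<and> p (q x) \<in> D \<and> nbhd T x \<inter> D = {p (q x)}"
    by metis
  \<comment> \<open>Each matching edge, named by its white end, is charged to a vertex of
    \<open>D\<close>: to its white end if possible, else to its black end. A missed edge takes the
    black end \<open>p (q x)\<close> of an edge inside \<open>D\<close>; that edge itself is charged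
    to \<open>q x\<close>.\<close>
  define g where "g x = (if x \<in> D then x else if p x \<in> D then p x else p (q x))" for x
  have black: "p x \<notin> W" if "x \<in> W" for x using p(2)[OF that] by (simp add: W_def)
  have "inj_on g W"
  proof (rule inj_onI)
    fix x y assume xy: "x \<in> W" "y \<in> W" "g x = g y"
    \<comment> \<open>Two missed edges charged to the same vertex would have white ends with the
      same trace on \<open>D\<close>.\<close>
    have "x = y" if "x \<notin> D" "p x \<notin> D" "y \<notin> D" "p y \<notin> D"
    proof (rule loc)
      show "nbhd T x \<inter> D = nbhd T y \<inter> D" using q xy that by (simp add: g_def)
    qed (use xy that in \<open>auto simp: W_def\<close>)
    \<comment> \<open>In the mixed cases \<open>black\<close> separates white values from black
      ones. If \<open>p x\<close> equals \<open>p (q y)\<close>, then \<open>p_inj\<close> gives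
      \<open>x = q y\<close>, which lies in \<open>D\<close>, whereas \<open>p x\<close> is charged
      only for \<open>x\<close> outside \<open>D\<close>.\<close>
    then show "x = y"
      using xy q[of x] q[of y] p_inj black unfolding g_def by (metis (full_types))
  qed
  moreover have "g ` W \<subseteq> D" using q by (auto simp: g_def)
  ultimately have "card W \<le> card D" using \<open>finite D\<close> by (rule card_inj_on_le)
  then show ?thesis using upper D(2) cardW cardM by simp
qed

theorem theorem12:
  fixes T :: "'a pair_pre_digraph"
  assumes "undirected_tree T"
    and "card (pverts T) \<ge> 2"
    and "\<not> (\<exists>u v. open_twins T u v)"
  shows "real (location_domination_number T) = real (card (pverts T)) / 2 \<longleftrightarrow> T \<in> family_T"
proof -
  have "real (location_domination_number T) = real (card (pverts T)) / 2 \<longleftrightarrow>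
      2 * location_domination_number T = card (pverts T)"
    by linarith
  then show ?thesis
    using half_location_domination_imp_family_T[OF assms]
      family_T_imp_half_location_domination[OF undirected_tree_nbhd_nonempty[OF assms(1,2)] assms(3)]
    by blast
qed

end
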